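(* Let $s_{\iota\to o}$ be a $\mathrm{QML}^{\mathrm{STT}}$-proposition (a simple type theory term of type $\iota\to o$ that is the translation of a quantified multimodal logic formula), and let $s=\overline{s_{\iota\to o}}$ be the corresponding formula of quantified multimodal logic (QML). If $\models^{\mathrm{QK}\pi} s$, that is, if $s$ is valid in all $\mathrm{QK}\pi$ models, then $\models^{\mathrm{STT}}(\mathrm{valid}\;s_{\iota\to o})$, that is, $\mathrm{valid}\;s_{\iota\to o}$ is Henkin-valid.
   Context: **Simple type theory (STT).** Simple types are freely generated from the base types $o$ (Booleans), $\mu$ (individuals), $\iota$ (possible worlds) by the function type constructor $\to$. Terms are built from typed constants $p_\alpha$, typed variables $X_\alpha$, abstraction $(\lambda X_\alpha.\, s_\beta)_{\alpha\to\beta}$, application $(s_{\alpha\to\beta}\,t_\alpha)_\beta$, and the logical symbols $\neg_{o\to o}$, $\vee_{o\to o\to o}$, $=_{\alpha\to\alpha\to o}$, $\Pi_{(\alpha\to o)\to o}$ (for every type $\alpha$). $\forall X_\alpha.\, s$ stands for $\Pi(\lambda X_\alpha.\, s)$. A frame is a family $\{D_\alpha\}_\alpha$ of nonempty sets with $D_o=\{T,F\}$ and $D_{\alpha\to\beta}$ a collection of functions from $D_\alpha$ to $D_\beta$. An interpretation is a frame with a function $I$ mapping each constant $c_\alpha$ to an element of $D_\alpha$, where $\neg,\vee,=,\Pi$ get their standard denotations. It is a Henkin (general) model if there is $\mathcal{V}$ such that, for all variable assignments $\phi$ (mapping each $X_\alpha$ into $D_\alpha$) and all terms $s_\alpha$,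 $\mathcal{V}_\phi s_\alpha\in D_\alpha$, and $\mathcal{V}_\phi X_\alpha=\phi X_\alpha$, $\mathcal{V}_\phi p_\alpha=I p_\alpha$, $\mathcal{V}_\phi(s\,t)=(\mathcal{V}_\phi s)(\mathcal{V}_\phi t)$, and $\mathcal{V}_\phi(\lambda X_\alpha.\, s_\beta)$ is the function $D_\alpha\to D_\beta$, $z\mapsto\mathcal{V}_{[z/X_\alpha]\phi}s_\beta$. A formula $A$ (term of type $o$) is Henkin-valid, written $\models^{\mathrm{STT}}A$, if $\mathcal{V}_\phi A=T$ in every Henkin model for every assignment $\phi$. **Quantified multimodal logic (QML).** Fix a set $\mathcal{IV}$ of individual variables, a set $\mathcal{PV}$ of propositional variables, a set $\mathcal{SYM}$ of predicate symbols of any arity, and an index set $S$. Formulas: $s,t ::= P \mid k(X^1,\dots,X^n)\mid \neg s\mid s\vee t\mid \forall X.\, s\mid\forall P.\, s\mid\Box_r s$, with $P\in\mathcal{PV}$, $k\in\mathcal{SYM}$ $n$-ary, $X,X^i\in\mathcal{IV}$, $r\in S$. A $\mathrm{QK}\pi^-$ model is $M=(W,(R_r)_{r\in S},D,P,(I_w)_{w\in W})$ where $W$ is a nonempty set of worlds, each $R_r\subseteq W\times W$, $D$ is a nonempty set, $P$ is a nonempty collection of subsets of $W$, and each $I_w$ maps each $n$-ary $k\in\mathcal{SYM}$ to an $n$-ary relation on $D$. A variable assignment $g$ maps $\mathcal{IV}$ to $D$ and $\mathcal{PV}$ to $P$. Satisfaction: $M,g,w\models k(X^1,\dots,X^n)$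 iff $\langle g(X^1),\dots,g(X^n)\rangle\in I_w(k)$; $M,g,w\models Q$ (for $Q\in\mathcal{PV}$) iff $w\in g(Q)$; $\neg$, $\vee$ as usual; $M,g,w\models\forall X.\, p$ iff $M,[d/X]g,w\models p$ for all $d\in D$; $M,g,w\models\forall Q.\, p$ iff $M,[v/Q]g,w\models p$ for all $v\in P$; $M,g,w\models\Box_r p$ iff $M,g,v\models p$ for all $v$ with $\langle w,v\rangle\in R_r$. A $\mathrm{QK}\pi$ model is a $\mathrm{QK}\pi^-$ model such that for every assignment $g$ and every QML formula $s$ the set $\{w\in W\mid M,g,w\models s\}$ belongs to $P$. A formula $s$ is valid in $M$ if $M,g,w\models s$ for all $g$ and all $w$; $\models^{\mathrm{QK}\pi}s$ means $s$ is valid in all $\mathrm{QK}\pi$ models. **Embedding.** The STT constants are: for each $n$-ary $k\in\mathcal{SYM}$ a constant $\dot k=k_{\mu\to\cdots\to\mu\to(\iota\to o)}$ ($n$ copies of $\mu$), and for each $r\in S$ a constant $\dot r=r_{\iota\to\iota\to o}$. Each $X\in\mathcal{IV}$ corresponds to an STT variable $\dot X=X_\mu$, each $P\in\mathcal{PV}$ to an STT variable $\dot P=P_{\iota\to o}$ (distinct variables to distinct variables). Define $\mathsf{mnot}=\lambda\phi_{\iota\to o}.\lambda W_\iota.\neg(\phi\,W)$; $\mathsf{mor}=\lambda\phi_{\iota\to o}.\lambda\psi_{\iota\to o}.\lambda W_\iota.\,\phi\,W\vee\psi\,W$; $\mathsf{mbox}=\lambda R_{\iota\to\iota\to o}.\lambda\phi_{\iota\to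 o}.\lambda W_\iota.\forall V_\iota.\,\neg(R\,W\,V)\vee\phi\,V$; $\mathsf{mall}^\mu=\lambda\phi_{\mu\to(\iota\to o)}.\lambda W_\iota.\forall X_\mu.\,\phi\,X\,W$; $\mathsf{mall}^{\iota\to o}=\lambda\phi_{(\iota\to o)\to(\iota\to o)}.\lambda W_\iota.\forall P_{\iota\to o}.\,\phi\,P\,W$; $\mathrm{valid}=\lambda\phi_{\iota\to o}.\forall W_\iota.\,\phi\,W$. The translation of formulas is: $\dot P=P_{\iota\to o}$; $k(X^1,\dots,X^n)\mapsto k\,X^1_\mu\cdots X^n_\mu$; $\neg s\mapsto\mathsf{mnot}\,\dot s$; $s\vee t\mapsto\mathsf{mor}\,\dot s\,\dot t$; $\Box_r s\mapsto\mathsf{mbox}\,\dot r\,\dot s$; $\forall X.\,s\mapsto\mathsf{mall}^\mu(\lambda X_\mu.\,\dot s)$; $\forall P.\,s\mapsto\mathsf{mall}^{\iota\to o}(\lambda P_{\iota\to o}.\,\dot s)$. The terms $\dot s$ so obtained are exactly the $\mathrm{QML}^{\mathrm{STT}}$-propositions; $s\mapsto\dot s$ is one-to-one, and $\overline{\,\cdot\,}$ denotes its inverse. *)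

theory Defs
  imports "HOL-Library.FuncSet"
begin

section \<open>Simple type theory with Henkin semantics\<close>

datatype ty = Omicron | Mu | Iota | Fun ty ty (infixr \<open>\<hookrightarrow>\<close> 70)

text \<open>The logical symbols are constants with a prescribed denotation; \<open>CPar c\<close> is the
  constant given by an element of the signature type \<^typ>\<open>'c\<close>.\<close>

datatype 'c const = CNot | COr | CEq ty | CPi ty | CPar 'c

text \<open>A variable is a name together with a type, so variables of different types are different
  even if they share a name.\<close>

datatype ('v, 'c) tm =
    Var 'v ty
  | Con "'c const"
  | Abs 'v ty "('v, 'c) tm"
  | App "('v, 'c) tm" "('v, 'c) tm" (infixl \<open>\<cdot>\<close> 200)

primrec const_ty :: "('c \<Rightarrow> ty) \<Rightarrow> 'c const \<Rightarrow> ty" where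
  "const_ty \<tau> CNot = Omicron \<hookrightarrow> Omicron"
| "const_ty \<tau> COr = Omicron \<hookrightarrow> Omicron \<hookrightarrow> Omicron"
| "const_ty \<tau> (CEq \<alpha>) = \<alpha> \<hookrightarrow> \<alpha> \<hookrightarrow> Omicron"
| "const_ty \<tau> (CPi \<alpha>) = (\<alpha> \<hookrightarrow> Omicron) \<hookrightarrow> Omicron"
| "const_ty \<tau> (CPar c) = \<tau> c"

inductive wt :: "('c \<Rightarrow> ty) \<Rightarrow> ('v, 'c) tm \<Rightarrow> ty \<Rightarrow> bool" for \<tau> :: "'c \<Rightarrow> ty" where
  wt_Var: "wt \<tau> (Var x \<alpha>) \<alpha>"
| wt_Con: "wt \<tau> (Con c) (const_ty \<tau> c)"
| wt_Abs: "wt \<tau> s \<beta> \<Longrightarrow> wt \<tau> (Abs x \<alpha> s) (\<alpha> \<hookrightarrow> \<beta>)"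
| wt_App: "wt \<tau> s (\<alpha> \<hookrightarrow> \<beta>) \<Longrightarrow> wt \<tau> t \<alpha> \<Longrightarrow> wt \<tau> (s \<cdot> t) \<beta>"

abbreviation tnot :: "('v, 'c) tm \<Rightarrow> ('v, 'c) tm" where
  "tnot s \<equiv> Con CNot \<cdot> s"

abbreviation tor :: "('v, 'c) tm \<Rightarrow> ('v, 'c) tm \<Rightarrow> ('v, 'c) tm" where
  "tor s t \<equiv> Con COr \<cdot> s \<cdot> t"

abbreviation tall :: "'v \<Rightarrow> ty \<Rightarrow> ('v, 'c) tm \<Rightarrow> ('v, 'c) tm" where
  "tall x \<alpha> s \<equiv> Con (CPi \<alpha>) \<cdot> Abs x \<alpha> s"

text \<open>The domains of a frame live at infinitely many different types, which no single HOL type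
  of genuine functions can accommodate. All domains are therefore taken inside one type
  \<^typ>\<open>'u\<close>, and an element \<open>f\<close> of the domain at type \<open>\<alpha> \<hookrightarrow> \<beta>\<close> stands for the
  function \<open>fun_of M \<alpha> \<beta> f\<close>. As \<open>fun_of M \<alpha> \<beta>\<close> is injective on that domain, the domain is
  in bijection with a collection of (extensional) functions between the two domains, so every
  frame is of this form up to renaming of the elements of its domains. The elements \<open>tt M\<close> and
  \<open>ff M\<close> are the truth values T and F.\<close>

record ('c, 'u) interp =
  Dom :: "ty \<Rightarrow> 'u set"
  fun_of :: "ty \<Rightarrow> ty \<Rightarrow> 'u \<Rightarrow> 'u \<Rightarrow> 'u"
  tt :: 'u
  ff :: 'u
  den :: "'c const \<Rightarrow> 'u"

definition is_frame :: "('c, 'u) interp \<Rightarrow> bool" where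
  "is_frame M \<longleftrightarrow>
     (\<forall>\<alpha>. Dom M \<alpha> \<noteq> {}) \<and>
     tt M \<noteq> ff M \<and> Dom M Omicron = {tt M, ff M} \<and>
     (\<forall>\<alpha> \<beta>. fun_of M \<alpha> \<beta> ` Dom M (\<alpha> \<hookrightarrow> \<beta>) \<subseteq> Dom M \<alpha> \<rightarrow>\<^sub>E Dom M \<beta> \<and>
            inj_on (fun_of M \<alpha> \<beta>) (Dom M (\<alpha> \<hookrightarrow> \<beta>)))"

definition truth :: "('c, 'u) interp \<Rightarrow> bool \<Rightarrow> 'u" where
  "truth M b = (if b then tt M else ff M)"

definition is_interp :: "('c \<Rightarrow> ty) \<Rightarrow> ('c, 'u) interp \<Rightarrow> bool" where
  "is_interp \<tau> M \<longleftrightarrow>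
     is_frame M \<and>
     (\<forall>c. den M c \<in> Dom M (const_ty \<tau> c)) \<and>
     (\<forall>a \<in> Dom M Omicron.
        fun_of M Omicron Omicron (den M CNot) a = truth M (a \<noteq> tt M)) \<and>
     (\<forall>a \<in> Dom M Omicron. \<forall>b \<in> Dom M Omicron.
        fun_of M Omicron Omicron (fun_of M Omicron (Omicron \<hookrightarrow> Omicron) (den M COr) a) b
          = truth M (a = tt M \<or> b = tt M)) \<and>
     (\<forall>\<alpha>. \<forall>a \<in> Dom M \<alpha>. \<forall>b \<in> Dom M \<alpha>.
        fun_of M \<alpha> Omicron (fun_of M \<alpha> (\<alpha> \<hookrightarrow> Omicron) (den M (CEq \<alpha>)) a) b
          = truth M (a = b)) \<and>
     (\<forall>\<alpha>. \<forall>f \<in> Dom M (\<alpha> \<hookrightarrow> Omicron).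
        fun_of M (\<alpha> \<hookrightarrow> Omicron) Omicron (den M (CPi \<alpha>)) f
          = truth M (\<forall>a \<in> Dom M \<alpha>. fun_of M \<alpha> Omicron f a = tt M))"

definition is_assign :: "('c, 'u) interp \<Rightarrow> ('v \<times> ty \<Rightarrow> 'u) \<Rightarrow> bool" where
  "is_assign M \<phi> \<longleftrightarrow> (\<forall>x \<alpha>. \<phi> (x, \<alpha>) \<in> Dom M \<alpha>)"

definition is_valuation ::
  "('c \<Rightarrow> ty) \<Rightarrow> ('c, 'u) interp \<Rightarrow> (('v \<times> ty \<Rightarrow> 'u) \<Rightarrow> ('v, 'c) tm \<Rightarrow> 'u) \<Rightarrow> bool" where
  "is_valuation \<tau> M V \<longleftrightarrow> (\<forall>\<phi>. is_assign M \<phi> \<longrightarrow>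
     (\<forall>s \<alpha>. wt \<tau> s \<alpha> \<longrightarrow> V \<phi> s \<in> Dom M \<alpha>) \<and>
     (\<forall>x \<alpha>. V \<phi> (Var x \<alpha>) = \<phi> (x, \<alpha>)) \<and>
     (\<forall>c. V \<phi> (Con c) = den M c) \<and>
     (\<forall>s t \<alpha> \<beta>. wt \<tau> s (\<alpha> \<hookrightarrow> \<beta>) \<longrightarrow> wt \<tau> t \<alpha> \<longrightarrow>
        V \<phi> (s \<cdot> t) = fun_of M \<alpha> \<beta> (V \<phi> s) (V \<phi> t)) \<and>
     (\<forall>x \<alpha> s \<beta>. wt \<tau> s \<beta> \<longrightarrow>
        fun_of M \<alpha> \<beta> (V \<phi> (Abs x \<alpha> s)) = (\<lambda>z \<in> Dom M \<alpha>. V (\<phi>((x, \<alpha>) := z)) s)))"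

text \<open>A Henkin model is an interpretation that has a valuation. The first argument only fixes the
  type containing the domains: HOL cannot quantify over types inside a definition.\<close>

definition henkin_valid :: "'u itself \<Rightarrow> ('c \<Rightarrow> ty) \<Rightarrow> ('v, 'c) tm \<Rightarrow> bool" where
  "henkin_valid U \<tau> A \<longleftrightarrow> wt \<tau> A Omicron \<and>
     (\<forall>(M :: ('c, 'u) interp) V \<phi>.
        is_interp \<tau> M \<and> is_valuation \<tau> M V \<and> is_assign M \<phi> \<longrightarrow> V \<phi> A = tt M)"


section \<open>Quantified multimodal logic\<close>

text \<open>The sets of individual variables, propositional variables, predicate symbols and modality
  indices are the types \<^typ>\<open>'x\<close>, \<^typ>\<open>'p\<close>, \<^typ>\<open>'k\<close> and \<^typ>\<open>'r\<close>.\<close>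

datatype ('x, 'p, 'k, 'r) qml =
    PVar 'p
  | Pred 'k "'x list"
  | Neg "('x, 'p, 'k, 'r) qml"
  | Disj "('x, 'p, 'k, 'r) qml" "('x, 'p, 'k, 'r) qml"
  | AllI 'x "('x, 'p, 'k, 'r) qml"
  | AllP 'p "('x, 'p, 'k, 'r) qml"
  | Box 'r "('x, 'p, 'k, 'r) qml"

primrec wf_qml :: "('k \<Rightarrow> nat) \<Rightarrow> ('x, 'p, 'k, 'r) qml \<Rightarrow> bool" where
  "wf_qml ar (PVar p) \<longleftrightarrow> True"
| "wf_qml ar (Pred k xs) \<longleftrightarrow> length xs = ar k"
| "wf_qml ar (Neg s) \<longleftrightarrow> wf_qml ar s"
| "wf_qml ar (Disj s t) \<longleftrightarrow> wf_qml ar s \<and> wf_qml ar t"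
| "wf_qml ar (AllI x s) \<longleftrightarrow> wf_qml ar s"
| "wf_qml ar (AllP p s) \<longleftrightarrow> wf_qml ar s"
| "wf_qml ar (Box r s) \<longleftrightarrow> wf_qml ar s"

record ('w, 'd, 'k, 'r) qmodel =
  Worlds :: "'w set"
  Acc :: "'r \<Rightarrow> ('w \<times> 'w) set"
  Indivs :: "'d set"
  Props :: "'w set set"
  Ext :: "'w \<Rightarrow> 'k \<Rightarrow> 'd list set"

definition is_QKpi_minus :: "('k \<Rightarrow> nat) \<Rightarrow> ('w, 'd, 'k, 'r) qmodel \<Rightarrow> bool" where
  "is_QKpi_minus ar M \<longleftrightarrow>
     Worlds M \<noteq> {} \<and>
     (\<forall>r. Acc M r \<subseteq> Worlds M \<times> Worlds M) \<and>
     Indivs M \<noteq> {} \<and>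
     Props M \<noteq> {} \<and> Props M \<subseteq> Pow (Worlds M) \<and>
     (\<forall>w \<in> Worlds M. \<forall>k. Ext M w k \<subseteq> {ds. length ds = ar k \<and> set ds \<subseteq> Indivs M})"

text \<open>A variable assignment is given by its restrictions \<open>g\<close> to individual variables and \<open>h\<close> to
  propositional variables.\<close>

definition is_qassign :: "('w, 'd, 'k, 'r) qmodel \<Rightarrow> ('x \<Rightarrow> 'd) \<Rightarrow> ('p \<Rightarrow> 'w set) \<Rightarrow> bool" where
  "is_qassign M g h \<longleftrightarrow> (\<forall>x. g x \<in> Indivs M) \<and> (\<forall>p. h p \<in> Props M)"

primrec sat :: "('w, 'd, 'k, 'r) qmodel \<Rightarrow> ('x \<Rightarrow> 'd) \<Rightarrow> ('p \<Rightarrow> 'w set) \<Rightarrow> 'w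
    \<Rightarrow> ('x, 'p, 'k, 'r) qml \<Rightarrow> bool" where
  "sat M g h w (PVar p) \<longleftrightarrow> w \<in> h p"
| "sat M g h w (Pred k xs) \<longleftrightarrow> map g xs \<in> Ext M w k"
| "sat M g h w (Neg s) \<longleftrightarrow> \<not> sat M g h w s"
| "sat M g h w (Disj s t) \<longleftrightarrow> sat M g h w s \<or> sat M g h w t"
| "sat M g h w (AllI x s) \<longleftrightarrow> (\<forall>d \<in> Indivs M. sat M (g(x := d)) h w s)"
| "sat M g h w (AllP p s) \<longleftrightarrow> (\<forall>v \<in> Props M. sat M g (h(p := v)) w s)"
| "sat M g h w (Box r s) \<longleftrightarrow> (\<forall>v. (w, v) \<in> Acc M r \<longrightarrow> sat M g h v s)"

text \<open>The closure condition ranges over all formulas, so the types of variables have to be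
  supplied as an argument.\<close>

definition is_QKpi :: "('x \<times> 'p) itself \<Rightarrow> ('k \<Rightarrow> nat) \<Rightarrow> ('w, 'd, 'k, 'r) qmodel \<Rightarrow> bool" where
  "is_QKpi X ar M \<longleftrightarrow>
     is_QKpi_minus ar M \<and>
     (\<forall>(g :: 'x \<Rightarrow> 'd) (h :: 'p \<Rightarrow> 'w set) s. is_qassign M g h \<longrightarrow> wf_qml ar s \<longrightarrow>
        {w \<in> Worlds M. sat M g h w s} \<in> Props M)"

definition valid_in :: "('w, 'd, 'k, 'r) qmodel \<Rightarrow> ('x, 'p, 'k, 'r) qml \<Rightarrow> bool" where
  "valid_in M s \<longleftrightarrow> (\<forall>g h w. is_qassign M g h \<longrightarrow> w \<in> Worlds M \<longrightarrow> sat M g h w s)"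

text \<open>The first argument fixes the types containing the worlds and the individuals.\<close>

definition QKpi_valid ::
  "('w \<times> 'd) itself \<Rightarrow> ('k \<Rightarrow> nat) \<Rightarrow> ('x, 'p, 'k, 'r) qml \<Rightarrow> bool" where
  "QKpi_valid U ar s \<longleftrightarrow>
     (\<forall>M :: ('w, 'd, 'k, 'r) qmodel. is_QKpi TYPE('x \<times> 'p) ar M \<longrightarrow> valid_in M s)"


section \<open>The embedding\<close>

text \<open>\<open>Aux\<close> supplies names for the bound variables of the combinators below, and infinitely
  many further variables at every type.\<close>

datatype ('x, 'p) name = IName 'x | PName 'p | Aux nat

datatype ('k, 'r) qconst = Sym 'k | Rel 'r

abbreviation iprop :: ty where
  "iprop \<equiv> Iota \<hookrightarrow> Omicron"

primrec qconst_ty :: "('k \<Rightarrow> nat) \<Rightarrow> ('k, 'r) qconst \<Rightarrow> ty" where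
  "qconst_ty ar (Sym k) = ((\<lambda>\<beta>. Mu \<hookrightarrow> \<beta>) ^^ ar k) iprop"
| "qconst_ty ar (Rel r) = Iota \<hookrightarrow> Iota \<hookrightarrow> Omicron"

type_synonym ('x, 'p, 'k, 'r) qtm = "(('x, 'p) name, ('k, 'r) qconst) tm"

definition mnot :: "('x, 'p, 'k, 'r) qtm" where
  "mnot =
    (let phi = Aux 0; W = Aux 1 in
     Abs phi iprop (Abs W Iota (tnot (Var phi iprop \<cdot> Var W Iota))))"

definition mor :: "('x, 'p, 'k, 'r) qtm" where
  "mor =
    (let phi = Aux 0; W = Aux 1; psi = Aux 2 in
     Abs phi iprop (Abs psi iprop (Abs W Iota
       (tor (Var phi iprop \<cdot> Var W Iota) (Var psi iprop \<cdot> Var W Iota)))))"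

definition mbox :: "('x, 'p, 'k, 'r) qtm" where
  "mbox =
    (let phi = Aux 0; W = Aux 1; V = Aux 2; R = Aux 3 in
     Abs R (Iota \<hookrightarrow> Iota \<hookrightarrow> Omicron) (Abs phi iprop (Abs W Iota
       (tall V Iota
         (tor (tnot (Var R (Iota \<hookrightarrow> Iota \<hookrightarrow> Omicron) \<cdot> Var W Iota \<cdot> Var V Iota))
              (Var phi iprop \<cdot> Var V Iota))))))"

text \<open>The quantifier combinator at type \<open>\<alpha>\<close>; it is used for \<open>\<alpha> = Mu\<close> and \<open>\<alpha> = iprop\<close>.\<close>

definition mall :: "ty \<Rightarrow> ('x, 'p, 'k, 'r) qtm" where
  "mall \<alpha> =
    (let phi = Aux 0; W = Aux 1; X = Aux 2 in
     Abs phi (\<alpha> \<hookrightarrow> iprop) (Abs W Iota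
       (tall X \<alpha> (Var phi (\<alpha> \<hookrightarrow> iprop) \<cdot> Var X \<alpha> \<cdot> Var W Iota))))"

definition mvalid :: "('x, 'p, 'k, 'r) qtm" where
  "mvalid =
    (let phi = Aux 0; W = Aux 1 in
     Abs phi iprop (tall W Iota (Var phi iprop \<cdot> Var W Iota)))"

primrec transl :: "('x, 'p, 'k, 'r) qml \<Rightarrow> ('x, 'p, 'k, 'r) qtm" where
  "transl (PVar p) = Var (PName p) iprop"
| "transl (Pred k xs) = foldl App (Con (CPar (Sym k))) (map (\<lambda>x. Var (IName x) Mu) xs)"
| "transl (Neg s) = mnot \<cdot> transl s"
| "transl (Disj s t) = mor \<cdot> transl s \<cdot> transl t"
| "transl (AllI x s) = mall Mu \<cdot> Abs (IName x) Mu (transl s)"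
| "transl (AllP p s) = mall iprop \<cdot> Abs (PName p) iprop (transl s)"
| "transl (Box r s) = mbox \<cdot> Con (CPar (Rel r)) \<cdot> transl s"

definition QML_STT_props :: "('k \<Rightarrow> nat) \<Rightarrow> ('x, 'p, 'k, 'r) qtm set" where
  "QML_STT_props ar = transl ` {s. wf_qml ar s}"

definition untransl :: "('k \<Rightarrow> nat) \<Rightarrow> ('x, 'p, 'k, 'r) qtm \<Rightarrow> ('x, 'p, 'k, 'r) qml" where
  "untransl ar = the_inv_into {s. wf_qml ar s} transl"

lemma wt_ConI: "const_ty \<tau> c = \<alpha> \<Longrightarrow> wt \<tau> (Con c) \<alpha>"
  using wt_Con by metis

lemma wt_mnot: "wt (qconst_ty ar) mnot (iprop \<hookrightarrow> iprop)"
  unfolding mnot_def Let_def by (rule wt.intros wt_ConI | simp)+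

lemma wt_mor: "wt (qconst_ty ar) mor (iprop \<hookrightarrow> iprop \<hookrightarrow> iprop)"
  unfolding mor_def Let_def by (rule wt_Abs wt_App wt_Var wt_ConI | simp)+

lemma wt_mbox: "wt (qconst_ty ar) mbox ((Iota \<hookrightarrow> Iota \<hookrightarrow> Omicron) \<hookrightarrow> iprop \<hookrightarrow> iprop)"
  unfolding mbox_def Let_def by (rule wt_Abs wt_App wt_Var wt_ConI | simp)+

lemma wt_mall: "wt (qconst_ty ar) (mall \<alpha>) ((\<alpha> \<hookrightarrow> iprop) \<hookrightarrow> iprop)"
  unfolding mall_def Let_def by (rule wt_Abs wt_App wt_Var wt_ConI | simp)+

lemma wt_mvalid: "wt (qconst_ty ar) mvalid (iprop \<hookrightarrow> Omicron)"
  unfolding mvalid_def Let_def by (rule wt_Abs wt_App wt_Var wt_ConI | simp)+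

lemma wt_foldl_App:
  assumes "wt \<tau> u (((\<lambda>\<beta>. Mu \<hookrightarrow> \<beta>) ^^ length xs) \<beta>)"
  shows "wt \<tau> (foldl App u (map (\<lambda>x. Var (IName x) Mu) xs)) \<beta>"
  using assms by (induction xs arbitrary: u) (auto intro: wt_App wt_Var)

lemma wt_transl:
  assumes "wf_qml ar s"
  shows "wt (qconst_ty ar) (transl s) iprop"
  using assms
proof (induction s)
  case (Pred k xs)
  then show ?case by (auto intro!: wt_foldl_App wt_ConI)
next
  case (Box r s)
  have "wt (qconst_ty ar) (Con (CPar (Rel r))) (Iota \<hookrightarrow> Iota \<hookrightarrow> Omicron)"
    by (rule wt_ConI) simp
  with Box show ?case by (auto intro: wt_App[OF wt_App[OF wt_mbox]])
qed (auto intro: wt_App wt_Var wt_Abs wt_mnot wt_mor wt_mall)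

lemma wt_valid_transl:
  assumes "wf_qml ar s"
  shows "wt (qconst_ty ar) (mvalid \<cdot> transl s) Omicron"
  using wt_App[OF wt_mvalid wt_transl[OF assms]] .

primrec head_of :: "('v, 'c) tm \<Rightarrow> ('v, 'c) tm" where
  "head_of (Var x \<alpha>) = Var x \<alpha>"
| "head_of (Con c) = Con c"
| "head_of (Abs x \<alpha> s) = Abs x \<alpha> s"
| "head_of (s \<cdot> t) = head_of s"

lemma head_of_foldl: "head_of (foldl App u ts) = head_of u"
  by (induction ts arbitrary: u) auto

lemma foldl_App_inj:
  "foldl App (Con c) (map (\<lambda>x. Var (f x) \<alpha>) xs) = foldl App (Con c) (map (\<lambda>x. Var (f x) \<alpha>) ys)
     \<Longrightarrow> inj f \<Longrightarrow> xs = ys"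
proof (induction xs arbitrary: ys rule: rev_induct)
  case Nil
  then show ?case by (cases ys rule: rev_cases) auto
next
  case (snoc x xs)
  then show ?case by (cases ys rule: rev_cases) (auto dest: injD)
qed

lemma head_of_transl [simp]:
  "head_of (transl (PVar p)) = Var (PName p) iprop"
  "head_of (transl (Pred k xs)) = Con (CPar (Sym k))"
  "head_of (transl (Neg s)) = mnot"
  "head_of (transl (Disj s t)) = mor"
  "head_of (transl (AllI x s)) = mall Mu"
  "head_of (transl (AllP p s)) = mall iprop"
  "head_of (transl (Box r s)) = mbox"
  by (simp_all add: head_of_foldl) (simp_all add: mnot_def mor_def mall_def mbox_def Let_def)

lemma head_distinct:
  "mnot \<noteq> mor" "mnot \<noteq> mbox" "mnot \<noteq> mall \<alpha>" "mor \<noteq> mbox" "mor \<noteq> mall \<alpha>" "mbox \<noteq> mall \<alpha>"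
  "mall Mu \<noteq> mall iprop"
  "mnot \<noteq> Con c" "mor \<noteq> Con c" "mbox \<noteq> Con c" "mall \<alpha> \<noteq> Con c"
  "mnot \<noteq> Var x \<beta>" "mor \<noteq> Var x \<beta>" "mbox \<noteq> Var x \<beta>" "mall \<alpha> \<noteq> Var x \<beta>"
  by (simp_all add: mnot_def mor_def mall_def mbox_def Let_def)

lemma transl_eqD: "transl s = transl t \<Longrightarrow> s = t"
proof (induction s arbitrary: t)
  case (PVar p)
  then have "head_of (transl t) = head_of (transl (PVar p))" by simp
  then show ?case by (cases t) (auto simp: head_distinct head_distinct[symmetric] simp del: transl.simps)
next
  case (Pred k xs)
  then have "head_of (transl t) = head_of (transl (Pred k xs))" by simp
  then obtain ys where t: "t = Pred k ys"
    by (cases t) (auto simp: head_distinct head_distinct[symmetric] simp del: transl.simps)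
  with Pred have "xs = ys" using foldl_App_inj[of _ IName] by (auto simp: inj_def)
  with t show ?case by simp
next
  case (Neg s)
  then have "head_of (transl t) = head_of (transl (Neg s))" by simp
  then obtain t1 where "t = Neg t1"
    by (cases t) (auto simp: head_distinct head_distinct[symmetric] simp del: transl.simps)
  with Neg show ?case by simp
next
  case (Disj s1 s2)
  then have "head_of (transl t) = head_of (transl (Disj s1 s2))" by simp
  then obtain t1 t2 where "t = Disj t1 t2"
    by (cases t) (auto simp: head_distinct head_distinct[symmetric] simp del: transl.simps)
  with Disj show ?case by simp
next
  case (AllI x s)
  then have "head_of (transl t) = head_of (transl (AllI x s))" by simp
  then obtain y t1 where "t = AllI y t1"
    by (cases t) (auto simp: head_distinct head_distinct[symmetric] simp del: transl.simps)
  with AllI show ?case by simp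
next
  case (AllP p s)
  then have "head_of (transl t) = head_of (transl (AllP p s))" by simp
  then obtain q t1 where "t = AllP q t1"
    by (cases t) (auto simp: head_distinct head_distinct[symmetric] simp del: transl.simps)
  with AllP show ?case by simp
next
  case (Box r s)
  then have "head_of (transl t) = head_of (transl (Box r s))" by simp
  then obtain q t1 where "t = Box q t1"
    by (cases t) (auto simp: head_distinct head_distinct[symmetric] simp del: transl.simps)
  with Box show ?case by simp
qed

lemma inj_transl: "inj transl"
  by (rule injI) (rule transl_eqD)

lemma untransl_transl: "wf_qml ar s \<Longrightarrow> untransl ar (transl s) = s"
  unfolding untransl_def by (intro the_inv_into_f_f inj_on_subset[OF inj_transl]) auto

end

theory Submission
  imports Defs
begin

text \<open>Every Henkin model induces a Kripke model: its worlds and individuals are the domains at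
  \<^term>\<open>Iota\<close> and \<^term>\<open>Mu\<close>, and its propositions are the sets represented by elements of the
  domain at \<^term>\<open>iprop\<close>. A world satisfies a formula in the Kripke model iff it belongs to the
  set denoted by the translation in the Henkin model. As the translation is a term, this set is a
  proposition, so the Kripke model is a model of QKpi, and validity of the formula in it is
  exactly truth of the embedded validity statement.\<close>

section \<open>Typing inversion as rewrite rules\<close>

lemma wt_Var_iff [simp]: "wt \<tau> (Var x \<alpha>) \<beta> \<longleftrightarrow> \<beta> = \<alpha>"
  by (auto intro: wt.intros elim: wt.cases)

lemma wt_Con_iff [simp]: "wt \<tau> (Con c) \<beta> \<longleftrightarrow> \<beta> = const_ty \<tau> c"
  by (auto intro: wt.intros elim: wt.cases)

lemma wt_Abs_iff [simp]: "wt \<tau> (Abs x \<alpha> s) \<gamma> \<longleftrightarrow> (\<exists>\<beta>. \<gamma> = \<alpha> \<hookrightarrow> \<beta> \<and> wt \<tau> s \<beta>)"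
  by (auto intro: wt.intros elim: wt.cases)

lemma wt_App_iff [simp]: "wt \<tau> (s \<cdot> t) \<beta> \<longleftrightarrow> (\<exists>\<alpha>. wt \<tau> s (\<alpha> \<hookrightarrow> \<beta>) \<and> wt \<tau> t \<alpha>)"
  by (auto intro: wt.intros elim: wt.cases)

section \<open>Evaluation of terms in a Henkin model\<close>

locale henkin_model =
  fixes \<tau> :: "'c \<Rightarrow> ty" and M :: "('c, 'u) interp"
    and V :: "('v \<times> ty \<Rightarrow> 'u) \<Rightarrow> ('v, 'c) tm \<Rightarrow> 'u"
  assumes interp: "is_interp \<tau> M" and valuation: "is_valuation \<tau> M V"
begin

lemma Dom_nonempty: "Dom M \<alpha> \<noteq> {}"
  using interp by (auto simp: is_interp_def is_frame_def)

lemma tt_neq_ff [simp]: "tt M \<noteq> ff M"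
  using interp by (auto simp: is_interp_def is_frame_def)

lemma truth_eq_tt [simp]: "truth M b = tt M \<longleftrightarrow> b"
  using tt_neq_ff by (metis truth_def)

lemma is_assign_upd [simp]:
  "is_assign M \<phi> \<Longrightarrow> z \<in> Dom M \<alpha> \<Longrightarrow> is_assign M (\<phi>((x, \<alpha>) := z))"
  by (auto simp: is_assign_def)

lemma assign_in_Dom [simp]: "is_assign M \<phi> \<Longrightarrow> \<phi> (x, \<alpha>) \<in> Dom M \<alpha>"
  by (auto simp: is_assign_def)

lemma V_in_Dom: "is_assign M \<phi> \<Longrightarrow> wt \<tau> s \<alpha> \<Longrightarrow> V \<phi> s \<in> Dom M \<alpha>"
  using valuation by (auto simp: is_valuation_def)

lemma V_Var [simp]: "is_assign M \<phi> \<Longrightarrow> V \<phi> (Var x \<alpha>) = \<phi> (x, \<alpha>)"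
  using valuation by (auto simp: is_valuation_def)

lemma V_Con [simp]: "is_assign M \<phi> \<Longrightarrow> V \<phi> (Con c) = den M c"
  using valuation by (auto simp: is_valuation_def)

lemma V_App:
  "is_assign M \<phi> \<Longrightarrow> wt \<tau> s (\<alpha> \<hookrightarrow> \<beta>) \<Longrightarrow> wt \<tau> t \<alpha> \<Longrightarrow>
    V \<phi> (s \<cdot> t) = fun_of M \<alpha> \<beta> (V \<phi> s) (V \<phi> t)"
  using valuation unfolding is_valuation_def by blast

lemma fun_of_V_Abs:
  assumes "is_assign M \<phi>" "wt \<tau> s \<beta>" "z \<in> Dom M \<alpha>"
  shows "fun_of M \<alpha> \<beta> (V \<phi> (Abs x \<alpha> s)) z = V (\<phi>((x, \<alpha>) := z)) s"
proof -
  have "fun_of M \<alpha> \<beta> (V \<phi> (Abs x \<alpha> s)) = (\<lambda>z \<in> Dom M \<alpha>. V (\<phi>((x, \<alpha>) := z)) s)"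
    using valuation assms unfolding is_valuation_def by blast
  with assms show ?thesis by simp
qed

text \<open>Beta reduction is done semantically: the argument is evaluated under the old assignment
  and its value stored at the bound variable. No substitution takes place, so the \<open>Aux\<close>
  names bound in the combinators cannot capture variables of the argument.\<close>

lemma V_beta:
  assumes "is_assign M \<phi>" "wt \<tau> s \<beta>" "wt \<tau> t \<alpha>"
  shows "V \<phi> (Abs x \<alpha> s \<cdot> t) = V (\<phi>((x, \<alpha>) := V \<phi> t)) s"
  using assms V_App[of \<phi> "Abs x \<alpha> s" \<alpha> \<beta> t] by (simp add: fun_of_V_Abs V_in_Dom)

lemma V_tnot:
  assumes "is_assign M \<phi>" "wt \<tau> s Omicron"
  shows "V \<phi> (tnot s) = tt M \<longleftrightarrow> V \<phi> s \<noteq> tt M"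
  using assms interp V_App[of \<phi> "Con CNot" Omicron Omicron s]
  by (simp add: V_in_Dom is_interp_def)

lemma V_tor:
  assumes "is_assign M \<phi>" "wt \<tau> s Omicron" "wt \<tau> t Omicron"
  shows "V \<phi> (tor s t) = tt M \<longleftrightarrow> V \<phi> s = tt M \<or> V \<phi> t = tt M"
  using assms interp V_App[of \<phi> "Con COr" Omicron "Omicron \<hookrightarrow> Omicron" s]
    V_App[of \<phi> "Con COr \<cdot> s" Omicron Omicron t]
  by (simp add: V_in_Dom is_interp_def)

lemma V_tall:
  assumes "is_assign M \<phi>" "wt \<tau> s Omicron"
  shows "V \<phi> (tall x \<alpha> s) = tt M \<longleftrightarrow> (\<forall>z \<in> Dom M \<alpha>. V (\<phi>((x, \<alpha>) := z)) s = tt M)"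
proof -
  have "V \<phi> (Abs x \<alpha> s) \<in> Dom M (\<alpha> \<hookrightarrow> Omicron)"
    using assms by (simp add: V_in_Dom)
  then show ?thesis
    using assms interp V_App[of \<phi> "Con (CPi \<alpha>)" "\<alpha> \<hookrightarrow> Omicron" Omicron "Abs x \<alpha> s"]
    by (simp add: is_interp_def fun_of_V_Abs)
qed

text \<open>In \<open>V_App\<close> the argument type cannot be read off the term. With a variable
  as head it can, so this form works as a rewrite rule on the bodies of the combinators.\<close>

lemma V_Var_App:
  assumes "is_assign M \<phi>" "wt \<tau> t \<alpha>"
  shows "V \<phi> (Var f (\<alpha> \<hookrightarrow> \<beta>) \<cdot> t) = fun_of M \<alpha> \<beta> (\<phi> (f, \<alpha> \<hookrightarrow> \<beta>)) (V \<phi> t)"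
  using assms V_App[of \<phi> "Var f (\<alpha> \<hookrightarrow> \<beta>)" \<alpha> \<beta> t] by simp

lemma V_Var_App2:
  assumes "is_assign M \<phi>" "wt \<tau> t \<alpha>" "wt \<tau> u \<beta>"
  shows "V \<phi> (Var f (\<alpha> \<hookrightarrow> \<beta> \<hookrightarrow> \<gamma>) \<cdot> t \<cdot> u) =
    fun_of M \<beta> \<gamma> (fun_of M \<alpha> (\<beta> \<hookrightarrow> \<gamma>) (\<phi> (f, \<alpha> \<hookrightarrow> \<beta> \<hookrightarrow> \<gamma>)) (V \<phi> t)) (V \<phi> u)"
  using assms V_App[of \<phi> "Var f (\<alpha> \<hookrightarrow> \<beta> \<hookrightarrow> \<gamma>) \<cdot> t" \<beta> \<gamma> u] by (simp add: V_Var_App)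

end

section \<open>The Kripke model induced by a Henkin model\<close>

definition ext_set :: "('c, 'u) interp \<Rightarrow> 'u \<Rightarrow> 'u set" where
  "ext_set M f = {w \<in> Dom M Iota. fun_of M Iota Omicron f w = tt M}"

text \<open>Each use of \<open>fun_of\<close> must be told the codomain type; a symbol that has just
  consumed \<open>d\<close> still expects \<open>length ds\<close> arguments, which determines
  it.\<close>

primrec mu_app :: "('c, 'u) interp \<Rightarrow> 'u \<Rightarrow> 'u list \<Rightarrow> 'u" where
  "mu_app M f [] = f"
| "mu_app M f (d # ds) =
    mu_app M (fun_of M Mu (((\<lambda>\<beta>. Mu \<hookrightarrow> \<beta>) ^^ length ds) iprop) f d) ds"

text \<open>Worlds and individuals both live in \<open>'u\<close>, so validity over the carrier
  types \<open>'u\<close> and \<open>'u\<close> covers this model. The guards in \<open>Acc\<close>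
  and \<open>Ext\<close> keep the relations inside the domains, outside of which
  \<open>fun_of\<close> has no prescribed behaviour.\<close>

definition kripke ::
  "('k \<Rightarrow> nat) \<Rightarrow> (('k, 'r) qconst, 'u) interp \<Rightarrow> ('u, 'u, 'k, 'r) qmodel" where
  "kripke ar M =
    \<lparr>Worlds = Dom M Iota,
     Acc = (\<lambda>r. {(w, v). w \<in> Dom M Iota \<and>
       v \<in> ext_set M (fun_of M Iota iprop (den M (CPar (Rel r))) w)}),
     Indivs = Dom M Mu,
     Props = ext_set M ` Dom M iprop,
     Ext = (\<lambda>w k. {ds. length ds = ar k \<and> set ds \<subseteq> Dom M Mu \<and>
       w \<in> ext_set M (mu_app M (den M (CPar (Sym k))) ds)})\<rparr>"

lemma kripke_sel [simp]:
  "Worlds (kripke ar M) = Dom M Iota"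
  "Indivs (kripke ar M) = Dom M Mu"
  "Props (kripke ar M) = ext_set M ` Dom M iprop"
  by (simp_all add: kripke_def)

definition ivars :: "(('x, 'p) name \<times> ty \<Rightarrow> 'u) \<Rightarrow> 'x \<Rightarrow> 'u" where
  "ivars \<phi> x = \<phi> (IName x, Mu)"

definition pvars :: "('c, 'u) interp \<Rightarrow> (('x, 'p) name \<times> ty \<Rightarrow> 'u) \<Rightarrow> 'p \<Rightarrow> 'u set" where
  "pvars M \<phi> p = ext_set M (\<phi> (PName p, iprop))"

text \<open>These match an update of the STT assignment at a translated bound variable with the
  update that \<open>sat\<close> makes at a quantifier.\<close>

lemma vars_upd:
  "ivars (\<phi>((IName x, Mu) := d)) = (ivars \<phi>)(x := d)"
  "pvars M (\<phi>((IName x, Mu) := d)) = pvars M \<phi>"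
  "ivars (\<phi>((PName p, iprop) := f)) = ivars \<phi>"
  "pvars M (\<phi>((PName p, iprop) := f)) = (pvars M \<phi>)(p := ext_set M f)"
  by (auto simp: ivars_def pvars_def fun_eq_iff)

section \<open>Denotations of translated formulas\<close>

locale qml_henkin_model =
  henkin_model "qconst_ty ar" M V
  for ar :: "'k \<Rightarrow> nat" and M :: "(('k, 'r) qconst, 'u) interp"
    and V :: "(('x, 'p) name \<times> ty \<Rightarrow> 'u) \<Rightarrow> ('x, 'p, 'k, 'r) qtm \<Rightarrow> 'u"
begin

lemma ext_mnot:
  assumes "is_assign M \<phi>" "wt (qconst_ty ar) s iprop"
  shows "ext_set M (V \<phi> (mnot \<cdot> s)) = Dom M Iota - ext_set M (V \<phi> s)"
  using assms
  by (auto simp: ext_set_def mnot_def Let_def V_beta fun_of_V_Abs V_in_Dom V_tnot V_Var_App)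

lemma ext_mor:
  assumes "is_assign M \<phi>" "wt (qconst_ty ar) s iprop" "wt (qconst_ty ar) t iprop"
  shows "ext_set M (V \<phi> (mor \<cdot> s \<cdot> t)) = ext_set M (V \<phi> s) \<union> ext_set M (V \<phi> t)"
proof -
  \<comment> \<open>\<open>V_beta\<close> needs an abstraction as immediate head, but
    \<open>mor\<close> takes two arguments. Both applications are turned into \<open>fun_of\<close>
    first, and \<open>fun_of_V_Abs\<close> then peels off the binders one at a time.\<close>
  have "V \<phi> (mor \<cdot> s \<cdot> t) =
    fun_of M iprop iprop (fun_of M iprop (iprop \<hookrightarrow> iprop) (V \<phi> mor) (V \<phi> s)) (V \<phi> t)"
    using assms V_App[of \<phi> "mor \<cdot> s" iprop iprop t] V_App[of \<phi> mor iprop "iprop \<hookrightarrow> iprop" s]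
    by (simp add: wt_mor exI[of _ iprop])
  with assms show ?thesis
    by (auto simp: ext_set_def mor_def Let_def fun_of_V_Abs V_in_Dom V_tor V_Var_App)
qed

lemma ext_mbox:
  assumes "is_assign M \<phi>" "wt (qconst_ty ar) s iprop"
  shows "ext_set M (V \<phi> (mbox \<cdot> Con (CPar (Rel r)) \<cdot> s)) =
    {w \<in> Dom M Iota. \<forall>v. (w, v) \<in> Acc (kripke ar M) r \<longrightarrow> v \<in> ext_set M (V \<phi> s)}"
proof -
  let ?R = "Con (CPar (Rel r)) :: ('x, 'p, 'k, 'r) qtm"
  have R: "wt (qconst_ty ar) ?R (Iota \<hookrightarrow> iprop)" by simp
  have "V \<phi> (mbox \<cdot> ?R \<cdot> s) = fun_of M iprop iprop
      (fun_of M (Iota \<hookrightarrow> iprop) (iprop \<hookrightarrow> iprop) (V \<phi> mbox) (V \<phi> ?R)) (V \<phi> s)"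
    using assms R V_App[of \<phi> "mbox \<cdot> ?R" iprop iprop s]
      V_App[of \<phi> mbox "Iota \<hookrightarrow> iprop" "iprop \<hookrightarrow> iprop" ?R]
    by (simp add: wt_mbox)
  with assms V_in_Dom[OF assms(1) R] show ?thesis
    by (auto simp: ext_set_def mbox_def Let_def fun_of_V_Abs V_in_Dom V_tor V_tnot V_tall
        V_Var_App V_Var_App2 kripke_def)
qed

text \<open>Keeping \<alpha> general serves both quantifiers; at \<open>iprop\<close> the range is
  the Henkin domain, which need not represent every set of worlds.\<close>

lemma ext_mall:
  assumes "is_assign M \<phi>" "wt (qconst_ty ar) s iprop"
  shows "ext_set M (V \<phi> (mall \<alpha> \<cdot> Abs x \<alpha> s)) =
    {w \<in> Dom M Iota. \<forall>d \<in> Dom M \<alpha>. w \<in> ext_set M (V (\<phi>((x, \<alpha>) := d)) s)}"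
proof -
  have "V \<phi> (Abs x \<alpha> s) \<in> Dom M (\<alpha> \<hookrightarrow> iprop)"
    using assms by (simp add: V_in_Dom)
  with assms show ?thesis
    by (auto simp: ext_set_def mall_def Let_def V_beta fun_of_V_Abs V_tall V_Var_App2)
qed

lemma mvalid_iff:
  assumes "is_assign M \<phi>" "wt (qconst_ty ar) s iprop"
  shows "V \<phi> (mvalid \<cdot> s) = tt M \<longleftrightarrow> Dom M Iota \<subseteq> ext_set M (V \<phi> s)"
  using assms
  by (auto simp: ext_set_def mvalid_def Let_def V_beta V_in_Dom V_tall V_Var_App)

text \<open>\<open>foldl\<close> collects the arguments on the head, so the induction generalises
  \<open>u\<close>; its type loses one \<open>Mu\<close> per argument, in step with the types in
  \<open>mu_app\<close>.\<close>

lemma V_foldl_App: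
  assumes "is_assign M \<phi>"
    and "wt (qconst_ty ar) u (((\<lambda>\<beta>. Mu \<hookrightarrow> \<beta>) ^^ length xs) iprop)"
  shows "V \<phi> (foldl App u (map (\<lambda>x. Var (IName x) Mu) xs)) = mu_app M (V \<phi> u) (map (ivars \<phi>) xs)"
  using assms(2)
proof (induction xs arbitrary: u)
  case (Cons x xs)
  then show ?case
    using assms(1) V_App[of \<phi> u Mu _ "Var (IName x) Mu"] by (simp add: ivars_def)
qed simp

lemma ext_transl:
  assumes "is_assign M \<phi>" "wf_qml ar s"
  shows "ext_set M (V \<phi> (transl s)) =
    {w \<in> Dom M Iota. sat (kripke ar M) (ivars \<phi>) (pvars M \<phi>) w s}"
  using assms
proof (induction s arbitrary: \<phi>)
  case (PVar p)
  then show ?case by (auto simp: pvars_def ext_set_def)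
next
  case (Pred k xs)
  then have "V \<phi> (transl (Pred k xs)) = mu_app M (den M (CPar (Sym k))) (map (ivars \<phi>) xs)"
    by (simp add: V_foldl_App)
  moreover have "set (map (ivars \<phi>) xs) \<subseteq> Dom M Mu"
    using Pred by (auto simp: ivars_def)
  ultimately show ?case using Pred by (auto simp: kripke_def ext_set_def)
next
  case (AllI x s)
  then have wf: "wf_qml ar s" by simp
  have "ext_set M (V (\<phi>((IName x, Mu) := d)) (transl s)) =
      {w \<in> Dom M Iota. sat (kripke ar M) ((ivars \<phi>)(x := d)) (pvars M \<phi>) w s}"
    if "d \<in> Dom M Mu" for d
    using AllI.IH[OF is_assign_upd[OF AllI.prems(1) that] wf, of "IName x"] unfolding vars_upd .
  with AllI.prems show ?case by (auto simp: ext_mall wt_transl)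
next
  case (AllP p s)
  then have wf: "wf_qml ar s" by simp
  \<comment> \<open>\<open>Props\<close> is the image of the domain at \<open>iprop\<close> under
    \<open>ext_set\<close>, so letting \<open>f\<close> run through that domain covers the whole
    range of the propositional quantifier.\<close>
  have "ext_set M (V (\<phi>((PName p, iprop) := f)) (transl s)) =
      {w \<in> Dom M Iota. sat (kripke ar M) (ivars \<phi>) ((pvars M \<phi>)(p := ext_set M f)) w s}"
    if "f \<in> Dom M iprop" for f
    using AllP.IH[OF is_assign_upd[OF AllP.prems(1) that] wf, of "PName p"] unfolding vars_upd .
  with AllP.prems show ?case by (auto simp: ext_mall wt_transl)
next
  case (Box r s)
  \<comment> \<open>The induction hypothesis describes satisfaction only at elements of the domain;
    every successor has to be one of them.\<close>
  have "Acc (kripke ar M) r \<subseteq> Dom M Iota \<times> Dom M Iota"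
    by (auto simp: kripke_def ext_set_def)
  with Box show ?case by (auto simp: ext_mbox wt_transl)
qed (auto simp: ext_mnot ext_mor wt_transl)

section \<open>Transfer of assignments and the closure condition\<close>

lemma is_qassign_vars:
  "is_assign M \<phi> \<Longrightarrow> is_qassign (kripke ar M) (ivars \<phi>) (pvars M \<phi>)"
  by (auto simp: is_qassign_def ivars_def pvars_def)

text \<open>The closure condition concerns arbitrary Kripke assignments, while
  \<open>ext_transl\<close> speaks only of those coming from STT assignments. Choosing a
  representative in the domain for each proposition shows that all of them do.\<close>

lemma qassign_lift:
  fixes g :: "'x \<Rightarrow> 'u" and h :: "'p \<Rightarrow> 'u set"
  assumes "is_qassign (kripke ar M) g h"
  obtains \<phi> :: "('x, 'p) name \<times> ty \<Rightarrow> 'u"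
  where "is_assign M \<phi>" "ivars \<phi> = g" "pvars M \<phi> = h"
proof -
  have "\<forall>p. \<exists>f \<in> Dom M iprop. h p = ext_set M f"
    using assms unfolding is_qassign_def kripke_sel by blast
  then obtain f where f: "\<And>p. f p \<in> Dom M iprop" "\<And>p. h p = ext_set M (f p)"
    by metis
  \<comment> \<open>Default values for all variables that do not translate a QML variable.\<close>
  have "\<forall>\<alpha>. \<exists>a. a \<in> Dom M \<alpha>"
    using Dom_nonempty by blast
  then obtain e where e: "\<And>\<alpha>. e \<alpha> \<in> Dom M \<alpha>"
    by metis
  define \<phi> :: "('x, 'p) name \<times> ty \<Rightarrow> 'u" where
    "\<phi> = (\<lambda>(n, \<alpha>). case n of
        IName x \<Rightarrow> if \<alpha> = Mu then g x else e \<alpha>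
      | PName p \<Rightarrow> if \<alpha> = iprop then f p else e \<alpha>
      | Aux _ \<Rightarrow> e \<alpha>)"
  have "is_assign M \<phi>"
    using assms f(1) e by (auto simp: is_assign_def is_qassign_def \<phi>_def split: name.split)
  moreover have "ivars \<phi> = g" "pvars M \<phi> = h"
    using f(2) by (auto simp: ivars_def pvars_def \<phi>_def)
  ultimately show thesis by (rule that)
qed

lemma is_QKpi_kripke: "is_QKpi TYPE('x \<times> 'p) ar (kripke ar M)"
  unfolding is_QKpi_def
proof (intro conjI allI impI)
  show "is_QKpi_minus ar (kripke ar M)"
    using Dom_nonempty by (auto simp: is_QKpi_minus_def kripke_def ext_set_def)
next
  fix g :: "'x \<Rightarrow> 'u" and h :: "'p \<Rightarrow> 'u set" and s :: "('x, 'p, 'k, 'r) qml"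
  assume "is_qassign (kripke ar M) g h" and wf: "wf_qml ar s"
  then obtain \<phi> :: "('x, 'p) name \<times> ty \<Rightarrow> 'u"
    where \<phi>: "is_assign M \<phi>" "ivars \<phi> = g" "pvars M \<phi> = h"
    by (blast elim: qassign_lift)
  have "{w \<in> Worlds (kripke ar M). sat (kripke ar M) g h w s} = ext_set M (V \<phi> (transl s))"
    using ext_transl[OF \<phi>(1) wf] \<phi>(2,3) by simp
  also have "\<dots> \<in> Props (kripke ar M)"
    using V_in_Dom[OF \<phi>(1) wt_transl[OF wf]] by simp
  finally show "{w \<in> Worlds (kripke ar M). sat (kripke ar M) g h w s} \<in> Props (kripke ar M)" .
qed

end

theorem theorem2:
  fixes ar :: "'k \<Rightarrow> nat"
    and t :: "('x, 'p, 'k, 'r) qtm"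
  assumes "t \<in> QML_STT_props ar"
    and "QKpi_valid TYPE('u \<times> 'u) ar (untransl ar t)"
  shows "henkin_valid TYPE('u) (qconst_ty ar) (mvalid \<cdot> t)"
proof -
  from assms(1) obtain s where s: "wf_qml ar s" "t = transl s"
    by (auto simp: QML_STT_props_def)
  have valid: "QKpi_valid TYPE('u \<times> 'u) ar s"
    using assms(2) s by (simp add: untransl_transl)
  have "V \<phi> (mvalid \<cdot> transl s) = tt M"
    if "is_interp (qconst_ty ar) M" "is_valuation (qconst_ty ar) M V" and \<phi>: "is_assign M \<phi>"
    for M :: "(('k, 'r) qconst, 'u) interp" and V and \<phi> :: "('x, 'p) name \<times> ty \<Rightarrow> 'u"
  proof -
    interpret qml_henkin_model ar M V
      using that by unfold_locales
    have "valid_in (kripke ar M) s"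
      using valid is_QKpi_kripke by (simp add: QKpi_valid_def)
    then have "Dom M Iota \<subseteq> ext_set M (V \<phi> (transl s))"
      using is_qassign_vars[OF \<phi>] ext_transl[OF \<phi> s(1)] by (auto simp: valid_in_def)
    then show ?thesis
      using mvalid_iff[OF \<phi> wt_transl[OF s(1)]] by simp
  qed
  with s show ?thesis
    \<comment> \<open>With \<open>wt_App_iff\<close> active the typing goal would be split into an
      existential statement that \<open>wt_valid_transl\<close> no longer matches.\<close>
    by (auto simp: henkin_valid_def intro: wt_valid_transl simp del: wt_App_iff)
qed

end
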